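(* Let $\gamma=(x,z):(I,t_0)\to(\mathbb{R}^2,\gamma_0)$ and $\widetilde\gamma=(\widetilde x,\widetilde z):(\widetilde I,\widetilde t_0)\to(\mathbb{R}^2,\widetilde\gamma_0)$ be smooth curves, where $\gamma_0=(x_0,z_0)$, $\widetilde\gamma_0=(\widetilde x_0,\widetilde z_0)$ and $x_0,\widetilde x_0>0$. Let $\theta_0\in[0,2\pi)$ and let $$\boldsymbol{z}:(I\times[0,2\pi),(t_0,\theta_0))\to((\mathbb{R}^2\setminus\{0\})\times\mathbb{R},\boldsymbol{z}_0),\qquad \widetilde{\boldsymbol{z}}:(\widetilde I\times[0,2\pi),(\widetilde t_0,\theta_0))\to((\mathbb{R}^2\setminus\{0\})\times\mathbb{R},\widetilde{\boldsymbol{z}}_0)$$ be the surfaces of revolution of $\gamma$ and $\widetilde\gamma$ around the $z$-axis, respectively. (1) If there exist diffeomorphism germs $\phi:(I,t_0)\to(\widetilde I,\widetilde t_0)$ and $\psi:(\mathbb{R}^2,\gamma_0)\to(\mathbb{R}^2,\widetilde\gamma_0)$, $\psi(X,Z)=(\psi_1(X,Z),\psi_2(X,Z))$, such that $\psi\circ\gamma=\widetilde\gamma\circ\phi$, then there exist diffeomorphism germs $\Phi:(I\times[0,2\pi),(t_0,\theta_0))\to(\widetilde I\times[0,2\pi),(\widetilde t_0,\theta_0))$ of the form $\Phi(t,\theta)=(\phi(t),\theta)$ and $\Psi:((\mathbb{R}^2\setminus\{0\})\times\mathbb{R},\boldsymbol{z}_0)\to((\mathbb{R}^2\setminus\{0\})\times\mathbb{R},\widetilde{\boldsymbol{z}}_0)$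 of the form $$\Psi(X,Y,Z)=\left(\frac{X\psi_1(\sqrt{X^2+Y^2},Z)}{\sqrt{X^2+Y^2}},\frac{Y\psi_1(\sqrt{X^2+Y^2},Z)}{\sqrt{X^2+Y^2}},\psi_2(\sqrt{X^2+Y^2},Z)\right)$$ such that $\Psi\circ\boldsymbol{z}=\widetilde{\boldsymbol{z}}\circ\Phi$. (2) If there exist diffeomorphism germs $\Phi:(I\times[0,2\pi),(t_0,\theta_0))\to(\widetilde I\times[0,2\pi),(\widetilde t_0,\theta_0))$ of the form $\Phi(t,\theta)=(\phi(t),\theta)$ and $\Psi=(\Psi_1,\Psi_2,\Psi_3):((\mathbb{R}^2\setminus\{0\})\times\mathbb{R},\boldsymbol{z}_0)\to((\mathbb{R}^2\setminus\{0\})\times\mathbb{R},\widetilde{\boldsymbol{z}}_0)$ such that $\Psi\circ\boldsymbol{z}=\widetilde{\boldsymbol{z}}\circ\Phi$, then there exists a diffeomorphism germ $\psi:(\mathbb{R}^2,\gamma_0)\to(\mathbb{R}^2,\widetilde\gamma_0)$, $\psi=(\psi_1,\psi_2)$, of the form \begin{align*} \psi_1(X,Z)&=\Psi_1(X\cos\theta_0,X\sin\theta_0,Z)\cos\theta_0+\Psi_2(X\cos\theta_0,X\sin\theta_0,Z)\sin\theta_0,\\ \psi_2(X,Z)&=\Psi_3(X\cos\theta_0,X\sin\theta_0,Z) \end{align*} such that $\psi\circ\gamma=\widetilde\gamma\circ\phi$.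
   Context: All maps are $C^\infty$ and are considered as germs at the indicated points. The surface of revolution of $\gamma=(x,z)$ around the $z$-axis is $\boldsymbol{z}(t,\theta)=(x(t)\cos\theta,x(t)\sin\theta,z(t))$, and similarly for $\widetilde\gamma$. Here $x_0=x(t_0)$, $z_0=z(t_0)$, $\boldsymbol{z}_0=\boldsymbol{z}(t_0,\theta_0)=(x_0\cos\theta_0,x_0\sin\theta_0,z_0)$ and $\widetilde{\boldsymbol z}_0=\widetilde{\boldsymbol z}(\widetilde t_0,\theta_0)$. Germs at $\theta_0$ are taken with $\theta$ ranging over a neighbourhood of $\theta_0$ in $\mathbb{R}$ (the formulas are $2\pi$-periodic in $\theta$). *)

theory Defs
  imports "HOL-Analysis.Analysis"
begin

text \<open>Only used for open sets \<open>S\<close>. Differentiating in every fixed direction \<open>v\<close> keeps the codomain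
  unchanged along the recursion; in finite dimension this is the usual class \<open>C\<^sup>k\<close> on \<open>S\<close>.\<close>

primrec Ck_on :: "nat \<Rightarrow> 'a::euclidean_space set \<Rightarrow> ('a \<Rightarrow> 'b::euclidean_space) \<Rightarrow> bool" where
  "Ck_on 0 S f \<longleftrightarrow> continuous_on S f"
| "Ck_on (Suc k) S f \<longleftrightarrow>
     (\<forall>x\<in>S. f differentiable (at x)) \<and>
     (\<forall>v. Ck_on k S (\<lambda>x. frechet_derivative f (at x) v))"

definition smooth_on :: "'a::euclidean_space set \<Rightarrow> ('a \<Rightarrow> 'b::euclidean_space) \<Rightarrow> bool" where
  "smooth_on S f \<longleftrightarrow> (\<forall>k. Ck_on k S f)"

text \<open>Germs are given by representatives, total functions whose values away from the base point are
  irrelevant. Accordingly, equality of germs at \<open>a\<close> is equality eventually in \<open>nhds a\<close>.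
  Below, \<open>f\<close> represents a germ \<open>(A, a) \<rightarrow> (B, b)\<close>; \<open>a\<close> is necessarily interior to \<open>A\<close>.\<close>

definition smooth_germ ::
  "'a::euclidean_space set \<Rightarrow> 'a \<Rightarrow> 'b::euclidean_space set \<Rightarrow> 'b \<Rightarrow> ('a \<Rightarrow> 'b) \<Rightarrow> bool" where
  "smooth_germ A a B b f \<longleftrightarrow>
     f a = b \<and> (\<exists>U. open U \<and> a \<in> U \<and> U \<subseteq> A \<and> f ` U \<subseteq> B \<and> smooth_on U f)"

definition diffeo_germ ::
  "'a::euclidean_space set \<Rightarrow> 'a \<Rightarrow> 'b::euclidean_space set \<Rightarrow> 'b \<Rightarrow> ('a \<Rightarrow> 'b) \<Rightarrow> bool" where
  "diffeo_germ A a B b f \<longleftrightarrow>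
     f a = b \<and>
     (\<exists>U V g. open U \<and> a \<in> U \<and> U \<subseteq> A \<and> open V \<and> b \<in> V \<and> V \<subseteq> B \<and>
        homeomorphism U V f g \<and> smooth_on U f \<and> smooth_on V g)"

definition surface_of_revolution :: "(real \<Rightarrow> real \<times> real) \<Rightarrow> real \<times> real \<Rightarrow> real \<times> real \<times> real" where
  "surface_of_revolution \<gamma> = (\<lambda>(t, \<theta>). (fst (\<gamma> t) * cos \<theta>, fst (\<gamma> t) * sin \<theta>, snd (\<gamma> t)))"

text \<open>The set \<open>(\<real>\<^sup>2 - {0}) \<times> \<real>\<close>.\<close>

definition off_axis :: "(real \<times> real \<times> real) set" where
  "off_axis = {(X, Y, Z). (X, Y) \<noteq> (0, 0)}"

end

theory Submission
  imports Defs
begin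

text \<open>
  The substance is in part (2), since \<open>\<Psi>\<close> need not preserve the half-plane at angle
  \<open>\<theta>\<^sub>0\<close>, and \<open>\<gamma>\<close> may even be constant, so that the surfaces carry little information about \<open>\<Psi>\<close>.

  Part (1): a diffeomorphism germ \<open>\<psi>\<close> of the \<open>(r, z)\<close>-plane at a point with \<open>r > 0\<close> induces a map of space
  that acts by \<open>\<psi>\<close> in every half-plane bounded by the axis and keeps the angle (\<open>revolve\<close>). Revolving is
  functorial as long as the first coordinate stays positive, so revolving \<open>\<psi>\<close> and its inverse gives inverse
  maps (\<open>revolve_inverse\<close>); they are smooth because the distance from the axis is smooth off the axis.

  Part (2): the stated \<open>\<psi>\<close> embeds the \<open>(r, z)\<close>-plane as the plane at angle \<open>\<theta>\<^sub>0\<close>, applies \<open>\<Psi>\<close>, and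
  projects orthogonally back to that plane. The kernel of the projection is spanned by the
  tangent vector \<open>e = (- sin \<theta>\<^sub>0, cos \<theta>\<^sub>0, 0)\<close> of the parallel circles. As \<open>\<Phi>\<close> keeps the angle,
  \<open>\<Psi>\<close> sends the parallel circle through the base point, near that point, to a parallel circle with the same angle
  parameter. Differentiating along it, the derivative of \<open>\<Psi>\<close> maps \<open>e\<close> to a nonzero multiple of \<open>e\<close>. If
  the derivative of \<open>\<psi>\<close> kills a vector \<open>w\<close>, then the derivative of \<open>\<Psi>\<close> maps the embedded \<open>w\<close> to a multiple
  of \<open>e\<close>; being injective, it forces the embedded \<open>w\<close> to be a multiple of \<open>e\<close>, hence \<open>w = 0\<close>
  (\<open>diffeo_germ_halfplane_section\<close>). The inverse function theorem then makes \<open>\<psi>\<close> a diffeomorphism germ.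

  Both parts rest on a calculus of iterated directional derivatives, which also upgrades the \<open>C\<^sup>1\<close> inverse
  function theorem to smooth maps of the plane (\<open>diffeo_germ_plane_inverse_function\<close>).
\<close>

section \<open>Calculus of smooth maps on open sets\<close>

lemma Ck_on_cong:
  assumes "open S" "\<And>x. x \<in> S \<Longrightarrow> f x = g x" "Ck_on k S f"
  shows "Ck_on k S g"
  using assms(2,3)
proof (induction k arbitrary: f g)
  case 0
  then show ?case
    by (metis Ck_on.simps(1) continuous_on_cong)
next
  case (Suc k)
  have g: "(g has_derivative frechet_derivative f (at x)) (at x)" if "x \<in> S" for x
    using Suc.prems that assms(1) frechet_derivative_works has_derivative_transform_within_open
    by (metis Ck_on.simps(2))
  have eq: "frechet_derivative f (at x) = frechet_derivative g (at x)" if "x \<in> S" for x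
    using frechet_derivative_at[OF g[OF that]] .
  have "Ck_on k S (\<lambda>x. frechet_derivative g (at x) v)" for v
    by (rule Suc.IH[of "\<lambda>x. frechet_derivative f (at x) v"]) (use Suc.prems(2) eq in auto)
  then show ?case
    using g by (auto simp: differentiable_def)
qed

lemma Ck_on_subset: "Ck_on k T f \<Longrightarrow> S \<subseteq> T \<Longrightarrow> Ck_on k S f"
  by (induction k arbitrary: f) (auto intro: continuous_on_subset)

text \<open>Any explicit derivative may replace the Frechet derivative in the recursion. It turns a
  differentiation formula into the induction step on the order of smoothness.\<close>
lemma Ck_on_SucI:
  assumes "open S" "\<And>x. x \<in> S \<Longrightarrow> (f has_derivative f' x) (at x)"
    and "\<And>v. Ck_on k S (\<lambda>x. f' x v)"
  shows "Ck_on (Suc k) S f"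
proof -
  have "f' x = frechet_derivative f (at x)" if "x \<in> S" for x
    using frechet_derivative_at[OF assms(2)[OF that]] .
  then have "Ck_on k S (\<lambda>x. frechet_derivative f (at x) v)" for v
    by (intro Ck_on_cong[OF assms(1) _ assms(3)[of v]]) simp
  then show ?thesis
    using assms(2) by (auto simp: differentiable_def)
qed

lemma Ck_on_SucD: "Ck_on (Suc k) S f \<Longrightarrow> Ck_on k S f"
proof (induction k arbitrary: f)
  case 0
  then show ?case
    by (simp add: continuous_at_imp_continuous_on differentiable_imp_continuous_within)
next
  case (Suc k)
  then show ?case
    by (metis Ck_on.simps(2))
qed

lemma Ck_on_Suc_has_derivative:
  "Ck_on (Suc k) S f \<Longrightarrow> x \<in> S \<Longrightarrow> (f has_derivative frechet_derivative f (at x)) (at x)"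
  by (simp add: frechet_derivative_works[symmetric])

lemma Ck_on_const: "open S \<Longrightarrow> Ck_on k S (\<lambda>x. c)"
proof (induction k arbitrary: c)
  case (Suc k)
  show ?case
    by (rule Ck_on_SucI[where f' = "\<lambda>x v. 0"]) (use Suc in auto)
qed simp

lemma Ck_on_linear:
  assumes "bounded_linear L" "open S" "Ck_on k S f"
  shows "Ck_on k S (\<lambda>x. L (f x))"
  using assms(3)
proof (induction k arbitrary: f)
  case 0
  then show ?case
    using bounded_linear.continuous_on[OF assms(1)] by simp
next
  case (Suc k)
  show ?case
    by (rule Ck_on_SucI[where f' = "\<lambda>x v. L (frechet_derivative f (at x) v)"])
      (use Suc assms bounded_linear.has_derivative[OF assms(1) Ck_on_Suc_has_derivative[OF Suc.prems]] in auto)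
qed

lemma Ck_on_id: "open S \<Longrightarrow> Ck_on k S (\<lambda>x. x)"
proof (cases k)
  case (Suc j)
  assume "open S"
  then show ?thesis
    unfolding Suc by (intro Ck_on_SucI[where f' = "\<lambda>x v. v"]) (auto intro: Ck_on_const)
qed auto

lemma Ck_on_add:
  assumes "open S" "Ck_on k S f" "Ck_on k S g"
  shows "Ck_on k S (\<lambda>x. f x + g x)"
  using assms(2,3)
proof (induction k arbitrary: f g)
  case (Suc k)
  show ?case
    by (rule Ck_on_SucI[where f' = "\<lambda>x v. frechet_derivative f (at x) v + frechet_derivative g (at x) v"])
      (use Suc assms has_derivative_add[OF Ck_on_Suc_has_derivative[OF Suc.prems(1)]
          Ck_on_Suc_has_derivative[OF Suc.prems(2)]] in auto)
qed (simp add: continuous_on_add)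

lemma Ck_on_sum:
  assumes "open S" "finite A" "\<And>i. i \<in> A \<Longrightarrow> Ck_on k S (f i)"
  shows "Ck_on k S (\<lambda>x. \<Sum>i\<in>A. f i x)"
  using assms(2,3) by (induction A rule: finite_induct) (auto intro: Ck_on_const Ck_on_add assms(1))

lemma Ck_on_bilinear:
  assumes "bounded_bilinear B" "open S" "Ck_on k S f" "Ck_on k S g"
  shows "Ck_on k S (\<lambda>x. B (f x) (g x))"
  using assms(3,4)
proof (induction k arbitrary: f g)
  case 0
  then show ?case
    using bounded_bilinear.continuous_on[OF assms(1)] by simp
next
  case (Suc k)
  show ?case
  proof (rule Ck_on_SucI[OF assms(2)])
    show "((\<lambda>x. B (f x) (g x)) has_derivative
        (\<lambda>v. B (f x) (frechet_derivative g (at x) v) + B (frechet_derivative f (at x) v) (g x))) (at x)"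
      if "x \<in> S" for x
      using that bounded_bilinear.FDERIV[OF assms(1) Ck_on_Suc_has_derivative[OF Suc.prems(1) that]
          Ck_on_Suc_has_derivative[OF Suc.prems(2) that]] by simp
    show "Ck_on k S (\<lambda>x. B (f x) (frechet_derivative g (at x) v) + B (frechet_derivative f (at x) v) (g x))"
      for v
      using Suc.prems(1,2)[THEN Ck_on_SucD] Suc.prems by (intro Ck_on_add assms(2) Suc.IH) simp_all
  qed
qed

text \<open>The chain rule gives the derivative \<open>g' (f x) (f' x v)\<close>, whose inner direction varies with \<open>x\<close>,
  whereas the induction hypothesis for \<open>g'\<close> speaks of fixed directions. Expanding \<open>f' x v\<close> in the
  standard basis reduces to those.\<close>
lemma Ck_on_compose:
  fixes f :: "'a::euclidean_space \<Rightarrow> 'b::euclidean_space" and g :: "'b \<Rightarrow> 'c::euclidean_space"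
  assumes "open S" "f ` S \<subseteq> T" "Ck_on k S f" "Ck_on k T g"
  shows "Ck_on k S (\<lambda>x. g (f x))"
  using assms(3,4)
proof (induction k arbitrary: g)
  case 0
  then show ?case
    using assms(2) by (auto intro: continuous_on_compose2)
next
  case (Suc k)
  let ?f' = "\<lambda>x. frechet_derivative f (at x)" and ?g' = "\<lambda>y. frechet_derivative g (at y)"
  show ?case
  proof (rule Ck_on_SucI[OF assms(1)])
    fix x assume x: "x \<in> S"
    have f: "(f has_derivative ?f' x) (at x)"
      using Ck_on_Suc_has_derivative[OF Suc.prems(1) x] .
    have g: "(g has_derivative ?g' (f x)) (at (f x))"
      using Ck_on_Suc_has_derivative[OF Suc.prems(2)] assms(2) x by blast
    interpret g': bounded_linear "?g' (f x)"
      using g by (rule has_derivative_bounded_linear)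
    have "?g' (f x) (?f' x v) = (\<Sum>b\<in>Basis. (?f' x v \<bullet> b) *\<^sub>R ?g' (f x) b)" for v
      by (metis (no_types, lifting) euclidean_representation g'.scaleR g'.sum sum.cong)
    then show "((\<lambda>x. g (f x)) has_derivative
        (\<lambda>v. \<Sum>b\<in>Basis. (?f' x v \<bullet> b) *\<^sub>R ?g' (f x) b)) (at x)"
      using has_derivative_compose[OF f g] by simp
  next
    fix v
    have "Ck_on k S (\<lambda>x. (?f' x v \<bullet> b) *\<^sub>R ?g' (f x) b)" for b
    proof (rule Ck_on_bilinear[OF bounded_bilinear_scaleR assms(1)])
      show "Ck_on k S (\<lambda>x. ?f' x v \<bullet> b)"
        using Suc.prems(1) by (intro Ck_on_linear[OF bounded_linear_inner_left assms(1)]) auto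
      show "Ck_on k S (\<lambda>x. ?g' (f x) b)"
        using Suc.prems(2) by (intro Suc.IH Ck_on_SucD[OF Suc.prems(1)]) auto
    qed
    then show "Ck_on k S (\<lambda>x. \<Sum>b\<in>Basis. (?f' x v \<bullet> b) *\<^sub>R ?g' (f x) b)"
      by (intro Ck_on_sum assms(1)) auto
  qed
qed

text \<open>The derivative of the reciprocal is a polynomial in the reciprocal, and that of the square
  root below is half the reciprocal of the square root, so in both cases each order of smoothness gives
  the next.\<close>
lemma Ck_on_inverse: "Ck_on k (- {0}) (inverse :: real \<Rightarrow> real)"
proof (induction k)
  case 0
  then show ?case
    by (auto intro!: continuous_intros)
next
  case (Suc k)
  show ?case
  proof (rule Ck_on_SucI)
    show "((inverse :: real \<Rightarrow> real) has_derivative (\<lambda>v. - (inverse x * v * inverse x))) (at x)"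
      if "x \<in> - {0}" for x :: real
      using that by (intro has_derivative_inverse') auto
    have "Ck_on k (- {0}) (\<lambda>x::real. (inverse x * inverse x) *\<^sub>R (- v))" for v :: real
      by (intro Ck_on_linear[OF bounded_linear_scaleR_left] Ck_on_bilinear[OF bounded_bilinear_mult] Suc)
        auto
    then show "Ck_on k (- {0}) (\<lambda>x::real. - (inverse x * v * inverse x))" for v :: real
      by (simp add: mult_ac)
  qed auto
qed

lemma Ck_on_sqrt: "Ck_on k {0<..} sqrt"
proof (induction k)
  case 0
  then show ?case
    by (auto intro!: continuous_intros)
next
  case (Suc k)
  show ?case
  proof (rule Ck_on_SucI)
    show "(sqrt has_derivative (*) (inverse (sqrt x) / 2)) (at x)" if "x \<in> {0<..}" for x
      using DERIV_real_sqrt[of x] that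
      by (simp add: has_field_derivative_def)
    have "Ck_on k {0<..} (\<lambda>x. inverse (sqrt x) *\<^sub>R (v / 2))" for v :: real
      by (intro Ck_on_linear[OF bounded_linear_scaleR_left] Ck_on_compose[OF _ _ Suc Ck_on_inverse]) auto
    then show "Ck_on k {0<..} (\<lambda>x. inverse (sqrt x) / 2 * v)" for v :: real
      by simp
  qed auto
qed

lemma smooth_on_subset: "smooth_on T f \<Longrightarrow> S \<subseteq> T \<Longrightarrow> smooth_on S f"
  unfolding smooth_on_def using Ck_on_subset by blast

lemma smooth_on_linear: "bounded_linear L \<Longrightarrow> open S \<Longrightarrow> smooth_on S f \<Longrightarrow> smooth_on S (\<lambda>x. L (f x))"
  by (simp add: smooth_on_def Ck_on_linear)

lemma smooth_on_bounded_linear: "bounded_linear L \<Longrightarrow> open S \<Longrightarrow> smooth_on S L"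
  unfolding smooth_on_def using Ck_on_linear[OF _ _ Ck_on_id] by blast

lemma smooth_on_add:
  "open S \<Longrightarrow> smooth_on S f \<Longrightarrow> smooth_on S g \<Longrightarrow> smooth_on S (\<lambda>x. f x + g x)"
  by (simp add: smooth_on_def Ck_on_add)

lemma smooth_on_mult:
  fixes f g :: "'a::euclidean_space \<Rightarrow> real"
  shows "open S \<Longrightarrow> smooth_on S f \<Longrightarrow> smooth_on S g \<Longrightarrow> smooth_on S (\<lambda>x. f x * g x)"
  by (simp add: smooth_on_def Ck_on_bilinear[OF bounded_bilinear_mult])

lemma smooth_on_compose:
  "open S \<Longrightarrow> f ` S \<subseteq> T \<Longrightarrow> smooth_on S f \<Longrightarrow> smooth_on T g \<Longrightarrow> smooth_on S (\<lambda>x. g (f x))"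
  by (simp add: smooth_on_def Ck_on_compose)

lemma Ck_on_Pair:
  assumes "open S" "Ck_on k S f" "Ck_on k S g"
  shows "Ck_on k S (\<lambda>x. (f x, g x))"
proof -
  have "bounded_linear (\<lambda>y. (y, 0))" "bounded_linear (\<lambda>y. (0, y))"
    by (auto intro!: bounded_linear_Pair bounded_linear_ident bounded_linear_zero)
  then have "Ck_on k S (\<lambda>x. (f x, 0) + (0, g x))"
    using assms(2,3) by (intro Ck_on_add assms(1) Ck_on_linear[of "\<lambda>y. (y, 0)"] Ck_on_linear[of "Pair 0"])
  then show ?thesis
    by simp
qed

lemma smooth_on_Pair:
  "open S \<Longrightarrow> smooth_on S f \<Longrightarrow> smooth_on S g \<Longrightarrow> smooth_on S (\<lambda>x. (f x, g x))"
  by (simp add: smooth_on_def Ck_on_Pair)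

lemma smooth_on_imp_continuous_on: "smooth_on S f \<Longrightarrow> continuous_on S f"
  unfolding smooth_on_def using Ck_on.simps(1) by blast

lemma smooth_on_has_derivative:
  "smooth_on S f \<Longrightarrow> x \<in> S \<Longrightarrow> (f has_derivative frechet_derivative f (at x)) (at x)"
  unfolding smooth_on_def using Ck_on_Suc_has_derivative by blast

lemma smooth_on_divide:
  fixes f g :: "'a::euclidean_space \<Rightarrow> real"
  assumes "open S" "smooth_on S f" "smooth_on S g" "\<And>x. x \<in> S \<Longrightarrow> g x \<noteq> 0"
  shows "smooth_on S (\<lambda>x. f x / g x)"
proof -
  have "smooth_on (- {0}) (inverse :: real \<Rightarrow> real)"
    by (simp add: smooth_on_def Ck_on_inverse)
  then have "smooth_on S (\<lambda>x. f x * inverse (g x))"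
    by (intro smooth_on_mult assms smooth_on_compose[OF assms(1) _ assms(3)]) (use assms(4) in auto)
  then show ?thesis
    by (simp add: divide_inverse)
qed

lemma smooth_on_sqrt:
  assumes "open S" "smooth_on S f" "\<And>x. x \<in> S \<Longrightarrow> f x > 0"
  shows "smooth_on S (\<lambda>x. sqrt (f x))"
proof (rule smooth_on_compose[OF assms(1) _ assms(2)])
  show "f ` S \<subseteq> {0<..}"
    using assms(3) by auto
qed (simp add: smooth_on_def Ck_on_sqrt)

section \<open>The smooth inverse function theorem in the plane\<close>

definition plane_det :: "(real \<times> real \<Rightarrow> real \<times> real) \<Rightarrow> real" where
  "plane_det A = fst (A (1, 0)) * snd (A (0, 1)) - fst (A (0, 1)) * snd (A (1, 0))"

lemma linear_plane_eq:
  fixes A :: "real \<times> real \<Rightarrow> real \<times> real"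
  assumes "linear A"
  shows "A (p, q) = p *\<^sub>R A (1, 0) + q *\<^sub>R A (0, 1)"
proof -
  have "A (p *\<^sub>R (1, 0) + q *\<^sub>R (0, 1)) = p *\<^sub>R A (1, 0) + q *\<^sub>R A (0, 1)"
    using assms by (simp only: linear_add linear_scale)
  then show ?thesis
    by simp
qed

lemma plane_det_nonzero:
  fixes A :: "real \<times> real \<Rightarrow> real \<times> real"
  assumes "linear A" "inj A"
  shows "plane_det A \<noteq> 0"
proof
  assume *: "plane_det A = 0"
  let ?a = "fst (A (1, 0))" and ?b = "fst (A (0, 1))" and ?c = "snd (A (1, 0))" and ?d = "snd (A (0, 1))"
  have "A (?d, - ?c) = 0" "A (- ?b, ?a) = 0"
    using * by (simp_all add: linear_plane_eq[OF assms(1), of ?d] linear_plane_eq[OF assms(1), of "- ?b"]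
        plane_det_def prod_eq_iff mult.commute)
  then have "(?d, - ?c) = 0" "(- ?b, ?a) = 0"
    using assms linear_injective_0 by blast+
  then have "A (1, 0) = A (0, 0)"
    using linear_0[OF assms(1)] by (simp add: prod_eq_iff zero_prod_def)
  then show False
    using assms(2) by (simp add: inj_eq)
qed

lemma inv_plane_cramer:
  fixes A :: "real \<times> real \<Rightarrow> real \<times> real"
  assumes "linear A" "inj A"
  shows "inv A v =
    ((snd (A (0, 1)) * fst v - fst (A (0, 1)) * snd v) / plane_det A,
     (fst (A (1, 0)) * snd v - snd (A (1, 0)) * fst v) / plane_det A)"
    (is "_ = ?w")
proof -
  let ?D = "plane_det A"
  have D: "?D \<noteq> 0"
    using plane_det_nonzero[OF assms] .
  have "?D * fst (A ?w) = ?D * fst v" "?D * snd (A ?w) = ?D * snd v"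
    using D unfolding linear_plane_eq[OF assms(1), of "fst ?w" "snd ?w", simplified]
    by (simp_all add: distrib_left; simp add: plane_det_def algebra_simps)+
  then have "A ?w = v"
    using D by (simp add: prod_eq_iff)
  then show ?thesis
    using assms(2) by (metis inv_f_f)
qed

text \<open>The derivative of \<open>g\<close> at \<open>y\<close> is the inverse matrix of the derivative of \<open>f\<close> at \<open>g y\<close>, which by
  Cramer's rule is a rational function of partial derivatives of \<open>f\<close> composed with \<open>g\<close>. Hence it is of
  class \<open>C\<^sup>k\<close> whenever \<open>g\<close> is, and then \<open>g\<close> is of class \<open>C\<^sup>k\<^sup>+\<^sup>1\<close>.\<close>
lemma smooth_on_plane_inverse:
  fixes f g :: "real \<times> real \<Rightarrow> real \<times> real"
  assumes "smooth_on U f" "homeomorphism U V f g" "open V"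
    and der: "\<And>y. y \<in> V \<Longrightarrow> (g has_derivative inv (frechet_derivative f (at (g y)))) (at y)"
    and inj: "\<And>y. y \<in> V \<Longrightarrow> inj (frechet_derivative f (at (g y)))"
  shows "smooth_on V g"
proof -
  have gV: "g ` V \<subseteq> U"
    using assms(2) by (simp add: homeomorphism_def)
  let ?A = "\<lambda>y. frechet_derivative f (at (g y))"
  have lin: "linear (?A y)" if "y \<in> V" for y
    using smooth_on_has_derivative[OF assms(1), of "g y"] gV that
    by (auto intro: has_derivative_linear)
  have "Ck_on k V g" for k
  proof (induction k)
    case 0
    then show ?case
      using assms(2) by (simp add: homeomorphism_def)
  next
    case (Suc k)
    have A: "Ck_on k V (\<lambda>y. ?A y w)" for w
    proof (rule Ck_on_compose[OF assms(3) gV Suc])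
      show "Ck_on k U (\<lambda>x. frechet_derivative f (at x) w)"
        using assms(1) unfolding smooth_on_def by (metis Ck_on.simps(2))
    qed
    have A1: "Ck_on k V (\<lambda>y. fst (?A y w))" and A2: "Ck_on k V (\<lambda>y. snd (?A y w))" for w
      using Ck_on_linear[OF bounded_linear_fst assms(3) A] Ck_on_linear[OF bounded_linear_snd assms(3) A]
      by auto
    note mult = Ck_on_bilinear[OF bounded_bilinear_mult assms(3)]
    have diff: "Ck_on k V (\<lambda>y. p y - q y)" if "Ck_on k V p" "Ck_on k V q" for p q :: "real \<times> real \<Rightarrow> real"
      using Ck_on_add[OF assms(3) that(1) Ck_on_linear[OF bounded_linear_minus[OF bounded_linear_ident] assms(3) that(2)]]
      by simp
    have inv_det: "Ck_on k V (\<lambda>y. inverse (plane_det (?A y)))"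
    proof (rule Ck_on_compose[OF assms(3) _ _ Ck_on_inverse])
      show "(\<lambda>y. plane_det (?A y)) ` V \<subseteq> - {0}"
        using plane_det_nonzero[OF lin inj] by auto
      show "Ck_on k V (\<lambda>y. plane_det (?A y))"
        unfolding plane_det_def by (intro diff mult A1 A2)
    qed
    show ?case
    proof (rule Ck_on_SucI[OF assms(3) der])
      fix v
      have "Ck_on k V (\<lambda>y.
          ((snd (?A y (0, 1)) * fst v - fst (?A y (0, 1)) * snd v) * inverse (plane_det (?A y)),
           (fst (?A y (1, 0)) * snd v - snd (?A y (1, 0)) * fst v) * inverse (plane_det (?A y))))"
        by (intro Ck_on_Pair diff mult A1 A2 inv_det assms(3) Ck_on_const)
      then show "Ck_on k V (\<lambda>y. inv (?A y) v)"
        by (rule Ck_on_cong[OF assms(3), rotated])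
          (simp add: inv_plane_cramer[OF lin inj] divide_inverse)
    qed
  qed
  then show ?thesis
    by (simp add: smooth_on_def)
qed

lemma diffeo_germ_plane_inverse_function:
  fixes f :: "real \<times> real \<Rightarrow> real \<times> real"
  assumes "open S" "a \<in> S" "smooth_on S f" "inj (frechet_derivative f (at a))"
  shows "diffeo_germ UNIV a UNIV (f a) f"
proof -
  let ?D = "\<lambda>x. Blinfun (frechet_derivative f (at x))"
  have der: "(f has_derivative frechet_derivative f (at x)) (at x)" if "x \<in> S" for x
    using smooth_on_has_derivative[OF assms(3) that] .
  have D: "blinfun_apply (?D x) = frechet_derivative f (at x)" if "x \<in> S" for x
    using bounded_linear_Blinfun_apply[OF has_derivative_bounded_linear[OF der[OF that]]] .
  have cont: "continuous_on S ?D"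
  proof (rule continuous_on_blinfun_componentwise)
    fix i :: "real \<times> real"
    have "continuous_on S (\<lambda>x. frechet_derivative f (at x) i)"
      using assms(3) unfolding smooth_on_def by (metis Ck_on.simps)
    then show "continuous_on S (\<lambda>x. blinfun_apply (?D x) i)"
      using D by (simp cong: continuous_on_cong)
  qed
  obtain h where h: "linear h" "h \<circ> frechet_derivative f (at a) = id"
    using linear_injective_left_inverse[OF has_derivative_linear[OF der[OF assms(2)]] assms(4)] by blast
  have "Blinfun h o\<^sub>L ?D a = id_blinfun"
    using h(2) by (intro blinfun_eqI)
      (simp add: D[OF assms(2)] bounded_linear_Blinfun_apply linear_conv_bounded_linear[THEN iffD1, OF h(1)] pointfree_idE)
  with assms(1,2) der cont obtain U V g g' where UV:
    "open U" "U \<subseteq> S" "a \<in> U" "open V" "f a \<in> V" "homeomorphism U V f g"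
    and g': "\<And>y. y \<in> V \<Longrightarrow> (g has_derivative g' y) (at y)"
      "\<And>y. y \<in> V \<Longrightarrow> g' y = inv (blinfun_apply (?D (g y)))"
      "\<And>y. y \<in> V \<Longrightarrow> bij (blinfun_apply (?D (g y)))"
    using inverse_function_theorem[of S f ?D a "Blinfun h"] D by metis
  have gy: "g y \<in> S" if "y \<in> V" for y
    using UV(2,6) that by (auto simp: homeomorphism_def)
  have U: "smooth_on U f"
    using smooth_on_subset[OF assms(3) UV(2)] .
  then have "smooth_on V g"
    using g' D[OF gy] by (intro smooth_on_plane_inverse[OF U UV(6,4)]) (auto simp: bij_is_inj)
  then show ?thesis
    using UV U unfolding diffeo_germ_def by blast
qed

section \<open>Revolving a plane map around the axis\<close>

definition meridian :: "real \<times> real \<times> real \<Rightarrow> real \<times> real" where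
  "meridian = (\<lambda>(X, Y, Z). (sqrt (X\<^sup>2 + Y\<^sup>2), Z))"

definition revolve :: "(real \<times> real \<Rightarrow> real \<times> real) \<Rightarrow> real \<times> real \<times> real \<Rightarrow> real \<times> real \<times> real" where
  "revolve \<psi> = (\<lambda>(X, Y, Z).
     (X * fst (\<psi> (sqrt (X\<^sup>2 + Y\<^sup>2), Z)) / sqrt (X\<^sup>2 + Y\<^sup>2),
      Y * fst (\<psi> (sqrt (X\<^sup>2 + Y\<^sup>2), Z)) / sqrt (X\<^sup>2 + Y\<^sup>2),
      snd (\<psi> (sqrt (X\<^sup>2 + Y\<^sup>2), Z))))"

lemma revolve_meridian:
  "revolve \<psi> p =
     (fst p * fst (\<psi> (meridian p)) / fst (meridian p),
      fst (snd p) * fst (\<psi> (meridian p)) / fst (meridian p),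
      snd (\<psi> (meridian p)))"
  by (simp add: revolve_def meridian_def split_beta)

lemma meridian_Pair: "meridian (X, Y, Z) = (sqrt (X\<^sup>2 + Y\<^sup>2), Z)"
  by (simp add: meridian_def)

lemma meridian_polar: "0 < r \<Longrightarrow> meridian (r * cos \<theta>, r * sin \<theta>, z) = (r, z)"
proof -
  assume "0 < r"
  have "(r * cos \<theta>)\<^sup>2 + (r * sin \<theta>)\<^sup>2 = r\<^sup>2 * ((cos \<theta>)\<^sup>2 + (sin \<theta>)\<^sup>2)"
    by (simp only: power_mult_distrib distrib_left)
  then have "(r * cos \<theta>)\<^sup>2 + (r * sin \<theta>)\<^sup>2 = r\<^sup>2"
    by (simp only: sin_cos_squared_add2 mult_1_right)
  with \<open>0 < r\<close> show ?thesis
    by (simp add: meridian_def)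
qed

lemma fst_meridian_pos_iff: "0 < fst (meridian p) \<longleftrightarrow> p \<in> off_axis"
  by (auto simp: meridian_def off_axis_def split_beta sum_power2_gt_zero_iff)

lemma continuous_on_meridian: "continuous_on S meridian"
  unfolding meridian_def split_beta by (intro continuous_intros)

text \<open>Revolving multiplies the horizontal part \<open>(X, Y)\<close>, of length \<open>r\<close>, by \<open>\<psi>\<^sub>1 / r\<close>. The new length is
  \<open>\<bar>\<psi>\<^sub>1\<bar>\<close>, so positivity of \<open>\<psi>\<^sub>1\<close> is what makes the new point lie over \<open>\<psi>\<close> of the old one.\<close>
lemma meridian_revolve:
  assumes "p \<in> off_axis" "0 < fst (\<psi> (meridian p))"
  shows "meridian (revolve \<psi> p) = \<psi> (meridian p)"
proof -
  obtain X Y Z where p: "p = (X, Y, Z)"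
    using prod_cases3 by blast
  define r s where "r = fst (meridian p)" and "s = fst (\<psi> (meridian p))"
  have r: "r > 0" "r\<^sup>2 = X\<^sup>2 + Y\<^sup>2"
    using assms(1) fst_meridian_pos_iff[of p] by (auto simp: r_def p meridian_Pair)
  have s: "s > 0"
    using assms(2) by (simp add: s_def)
  have "(X * s / r)\<^sup>2 + (Y * s / r)\<^sup>2 = (X\<^sup>2 + Y\<^sup>2) * s\<^sup>2 / r\<^sup>2"
    by (simp add: power_mult_distrib power_divide add_divide_distrib distrib_right)
  also have "\<dots> = s\<^sup>2"
    using r by auto
  finally have "sqrt ((X * s / r)\<^sup>2 + (Y * s / r)\<^sup>2) = s"
    using s by simp
  moreover have "revolve \<psi> p = (X * s / r, Y * s / r, snd (\<psi> (meridian p)))"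
    by (simp add: revolve_meridian r_def s_def) (simp add: p)
  ultimately show ?thesis
    by (simp add: meridian_Pair s_def)
qed

lemma revolve_inverse:
  assumes "p \<in> off_axis" "0 < fst (\<psi> (meridian p))" "g (\<psi> (meridian p)) = meridian p"
  shows "revolve g (revolve \<psi> p) = p"
proof -
  have "0 < fst (meridian p)"
    using assms(1) fst_meridian_pos_iff by blast
  then show ?thesis
    using assms(2)
    unfolding revolve_meridian[of g] meridian_revolve[of p \<psi>, OF assms(1,2)] assms(3)
    by (simp add: revolve_meridian prod_eq_iff) (simp add: meridian_def split_beta)
qed

lemma open_off_axis: "open off_axis"
proof -
  have "off_axis = meridian -` {q. 0 < fst q}"
    using fst_meridian_pos_iff by auto
  moreover have "open {q :: real \<times> real. 0 < fst q}"
    by (intro open_Collect_less continuous_intros)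
  ultimately show ?thesis
    using open_vimage continuous_on_meridian by metis
qed

lemma smooth_on_meridian:
  assumes "open S" "S \<subseteq> off_axis"
  shows "smooth_on S meridian"
proof -
  have X: "smooth_on S fst" and Y: "smooth_on S (\<lambda>p. fst (snd p))" and Z: "smooth_on S (\<lambda>p. snd (snd p))"
    using assms(1)
    by (auto intro!: smooth_on_bounded_linear bounded_linear_fst_comp bounded_linear_snd_comp
        bounded_linear_fst bounded_linear_snd)
  have "smooth_on S (\<lambda>p. (sqrt (fst p * fst p + fst (snd p) * fst (snd p)), snd (snd p)))"
  proof (intro smooth_on_Pair smooth_on_sqrt smooth_on_add smooth_on_mult X Y Z assms(1))
    show "0 < fst p * fst p + fst (snd p) * fst (snd p)" if "p \<in> S" for p
      using that assms(2) by (auto simp: off_axis_def split_beta sum_squares_gt_zero_iff)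
  qed
  then show ?thesis
    by (simp add: meridian_def case_prod_unfold power2_eq_square)
qed

lemma smooth_on_revolve:
  assumes "open S" "S \<subseteq> off_axis" "meridian ` S \<subseteq> T" "smooth_on T \<psi>"
  shows "smooth_on S (revolve \<psi>)"
proof -
  have m: "smooth_on S meridian"
    using smooth_on_meridian[OF assms(1,2)] .
  have \<psi>: "smooth_on S (\<lambda>p. \<psi> (meridian p))"
    using smooth_on_compose[OF assms(1,3) m assms(4)] .
  have nz: "fst (meridian p) \<noteq> 0" if "p \<in> S" for p
    using that assms(2) by (metis fst_meridian_pos_iff less_irrefl subsetD)
  have X: "smooth_on S fst" and Y: "smooth_on S (\<lambda>p. fst (snd p))"
    using assms(1)
    by (auto intro!: smooth_on_bounded_linear bounded_linear_fst_comp bounded_linear_fst bounded_linear_snd)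
  have "smooth_on S (\<lambda>p.
     (fst p * fst (\<psi> (meridian p)) / fst (meridian p),
      fst (snd p) * fst (\<psi> (meridian p)) / fst (meridian p),
      snd (\<psi> (meridian p))))"
    by (intro smooth_on_Pair smooth_on_divide smooth_on_mult X Y assms(1)
        smooth_on_linear[OF bounded_linear_fst _ \<psi>] smooth_on_linear[OF bounded_linear_snd _ \<psi>]
        smooth_on_linear[OF bounded_linear_fst _ m] nz)
  then show ?thesis
    by (simp add: revolve_meridian[abs_def])
qed

lemma diffeo_germ_revolve:
  assumes "diffeo_germ UNIV (x0, z0) UNIV (x1, z1) \<psi>" "0 < x0" "0 < x1"
  shows "diffeo_germ off_axis (x0 * cos \<theta>, x0 * sin \<theta>, z0) off_axis (x1 * cos \<theta>, x1 * sin \<theta>, z1) (revolve \<psi>)"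
proof -
  obtain U V g where UV: "open U" "(x0, z0) \<in> U" "open V" "(x1, z1) \<in> V" "homeomorphism U V \<psi> g"
    "smooth_on U \<psi>" "smooth_on V g" and \<psi>0: "\<psi> (x0, z0) = (x1, z1)"
    using assms(1) unfolding diffeo_germ_def by blast
  let ?H = "{q :: real \<times> real. 0 < fst q}"
  have H: "open ?H"
    by (intro open_Collect_less continuous_intros)
  \<comment> \<open>The first coordinates of \<open>\<psi>\<close> and of its inverse \<open>g\<close> are positive at the base points but perhaps not on
    all of \<open>U\<close> and \<open>V\<close>; the neighbourhoods are cut down to where they are.\<close>
  define U' V' where "U' = off_axis \<inter> meridian -` (U \<inter> \<psi> -` ?H)"
    and "V' = off_axis \<inter> meridian -` (V \<inter> g -` ?H)"
  have "open (U \<inter> \<psi> -` ?H)" "open (V \<inter> g -` ?H)"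
    using UV H continuous_open_preimage smooth_on_imp_continuous_on by blast+
  then have op: "open U'" "open V'"
    unfolding U'_def V'_def
    by (auto intro!: open_Int open_off_axis open_vimage continuous_on_meridian simp del: vimage_Int)
  have gf: "g (\<psi> q) = q" "\<psi> q \<in> V" if "q \<in> U" for q
    using UV(5) that by (auto simp: homeomorphism_def)
  have fg: "\<psi> (g q) = q" "g q \<in> U" if "q \<in> V" for q
    using UV(5) that by (auto simp: homeomorphism_def)
  have rU: "revolve \<psi> p \<in> V'" "revolve g (revolve \<psi> p) = p" if "p \<in> U'" for p
  proof -
    have p: "p \<in> off_axis" "0 < fst (\<psi> (meridian p))" "meridian p \<in> U"
      using that by (auto simp: U'_def)
    then show "revolve g (revolve \<psi> p) = p"
      using gf revolve_inverse by blast
    show "revolve \<psi> p \<in> V'"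
      using p gf[OF p(3)] meridian_revolve[of p \<psi>, OF p(1,2)] fst_meridian_pos_iff[of p]
        fst_meridian_pos_iff[of "revolve \<psi> p"]
      by (simp add: V'_def)
  qed
  have rV: "revolve g p \<in> U'" "revolve \<psi> (revolve g p) = p" if "p \<in> V'" for p
  proof -
    have p: "p \<in> off_axis" "0 < fst (g (meridian p))" "meridian p \<in> V"
      using that by (auto simp: V'_def)
    then show "revolve \<psi> (revolve g p) = p"
      using fg revolve_inverse by blast
    show "revolve g p \<in> U'"
      using p fg[OF p(3)] meridian_revolve[of p g, OF p(1,2)] fst_meridian_pos_iff[of p]
        fst_meridian_pos_iff[of "revolve g p"]
      by (simp add: U'_def)
  qed
  have sm: "smooth_on U' (revolve \<psi>)" "smooth_on V' (revolve g)"
    by (rule smooth_on_revolve[OF op(1) _ _ UV(6)] smooth_on_revolve[OF op(2) _ _ UV(7)];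
        force simp: U'_def V'_def)+
  have hom: "homeomorphism U' V' (revolve \<psi>) (revolve g)"
    using rU rV smooth_on_imp_continuous_on sm by (intro homeomorphismI) auto
  have pos: "(r * cos \<theta>, r * sin \<theta>, z) \<in> off_axis" if "0 < r" for r z
    using that fst_meridian_pos_iff[of "(r * cos \<theta>, r * sin \<theta>, z)"] by (simp add: meridian_polar)
  have "revolve \<psi> (x0 * cos \<theta>, x0 * sin \<theta>, z0) = (x1 * cos \<theta>, x1 * sin \<theta>, z1)"
    using assms(2) \<psi>0 by (simp add: revolve_meridian meridian_polar)
  moreover have "(x0 * cos \<theta>, x0 * sin \<theta>, z0) \<in> U'"
    using pos[OF assms(2)] UV(2) \<psi>0 assms(2,3) by (simp add: U'_def meridian_polar)
  moreover have "(x1 * cos \<theta>, x1 * sin \<theta>, z1) \<in> V'"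
    using pos[OF assms(3)] UV(2,4) gf(1)[OF UV(2)] \<psi>0 assms(2,3) by (simp add: V'_def meridian_polar)
  moreover have "U' \<subseteq> off_axis" "V' \<subseteq> off_axis"
    by (auto simp: U'_def V'_def)
  ultimately show ?thesis
    unfolding diffeo_germ_def using op hom sm by blast
qed

lemma diffeo_germ_times_UNIV:
  fixes \<phi> :: "'a::euclidean_space \<Rightarrow> 'b::euclidean_space" and c :: "'c::euclidean_space"
  assumes "diffeo_germ A a B b \<phi>"
  shows "diffeo_germ (A \<times> UNIV) (a, c) (B \<times> UNIV) (b, c) (\<lambda>(t, \<theta>). (\<phi> t, \<theta>))"
proof -
  obtain U V g where UV: "open U" "a \<in> U" "U \<subseteq> A" "open V" "b \<in> V" "V \<subseteq> B" "homeomorphism U V \<phi> g"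
    "smooth_on U \<phi>" "smooth_on V g" and \<phi>: "\<phi> a = b"
    using assms unfolding diffeo_germ_def by blast
  have sm: "smooth_on (W \<times> UNIV) (\<lambda>(t, \<theta>::'c). (f t, \<theta>))"
    if "open W" "smooth_on W f" for W and f :: "'d::euclidean_space \<Rightarrow> 'e::euclidean_space"
  proof -
    have W: "open (W \<times> (UNIV :: 'c set))"
      using that(1) by (simp add: open_Times)
    have "smooth_on (W \<times> UNIV) (\<lambda>p :: 'd \<times> 'c. f (fst p))"
      using that by (intro smooth_on_compose[OF W, of fst W f] smooth_on_bounded_linear[OF _ W] bounded_linear_fst) auto
    then have "smooth_on (W \<times> UNIV) (\<lambda>p :: 'd \<times> 'c. (f (fst p), snd p))"
      by (intro smooth_on_Pair W) (auto intro: smooth_on_bounded_linear W bounded_linear_snd)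
    then show ?thesis
      by (simp add: case_prod_unfold)
  qed
  have s1: "smooth_on (U \<times> UNIV) (\<lambda>(t, \<theta>::'c). (\<phi> t, \<theta>))" and s2: "smooth_on (V \<times> UNIV) (\<lambda>(t, \<theta>::'c). (g t, \<theta>))"
    using sm UV by blast+
  have "homeomorphism (U \<times> UNIV) (V \<times> UNIV) (\<lambda>(t, \<theta>::'c). (\<phi> t, \<theta>)) (\<lambda>(t, \<theta>). (g t, \<theta>))"
    using UV(7) s1[THEN smooth_on_imp_continuous_on] s2[THEN smooth_on_imp_continuous_on]
    by (intro homeomorphismI) (auto simp: homeomorphism_def)
  then show ?thesis
    unfolding diffeo_germ_def using UV \<phi> s1 s2
    by (intro conjI exI[of _ "U \<times> UNIV"] exI[of _ "V \<times> UNIV"] exI[of _ "\<lambda>(t, \<theta>). (g t, \<theta>)"])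
      (auto simp: open_Times)
qed

section \<open>Restricting a space map to a half-plane\<close>

definition halfplane_embedding :: "real \<Rightarrow> real \<times> real \<Rightarrow> real \<times> real \<times> real" where
  "halfplane_embedding \<theta> = (\<lambda>(X, Z). (X * cos \<theta>, X * sin \<theta>, Z))"

definition halfplane_projection :: "real \<Rightarrow> real \<times> real \<times> real \<Rightarrow> real \<times> real" where
  "halfplane_projection \<theta> = (\<lambda>(X, Y, Z). (X * cos \<theta> + Y * sin \<theta>, Z))"

lemma bounded_linear_halfplane_embedding: "bounded_linear (halfplane_embedding \<theta>)"
  unfolding halfplane_embedding_def case_prod_unfold
  by (intro bounded_linear_Pair bounded_linear_mult_const bounded_linear_fst bounded_linear_snd)

lemma bounded_linear_halfplane_projection: "bounded_linear (halfplane_projection \<theta>)"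
  unfolding halfplane_projection_def case_prod_unfold
  by (intro bounded_linear_Pair bounded_linear_add bounded_linear_mult_const bounded_linear_fst
      bounded_linear_fst_comp bounded_linear_snd_comp bounded_linear_snd)

lemma halfplane_projection_embedding: "halfplane_projection \<theta> (halfplane_embedding \<theta> q) = q"
proof -
  have "x * cos \<theta> * cos \<theta> + x * sin \<theta> * sin \<theta> = x" for x
    by (simp only: mult.assoc distrib_left[symmetric] power2_eq_square[symmetric] sin_cos_squared_add2 mult_1_right)
  then show ?thesis
    by (simp add: halfplane_projection_def halfplane_embedding_def case_prod_unfold)
qed

lemma kernel_halfplane_projection:
  assumes "halfplane_projection \<theta> v = 0"
  obtains c where "v = c *\<^sub>R (- sin \<theta>, cos \<theta>, 0)"
proof -
  obtain X Y Z where v: "v = (X, Y, Z)"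
    using prod_cases3 by blast
  have 0: "X * cos \<theta> + Y * sin \<theta> = 0" "Z = 0"
    using assms by (simp_all add: v halfplane_projection_def zero_prod_def)
  have "(Y * cos \<theta> - X * sin \<theta>) * - sin \<theta> = X" "(Y * cos \<theta> - X * sin \<theta>) * cos \<theta> = Y"
    using 0(1) sin_cos_squared_add[of \<theta>] by algebra+
  then have "v = (Y * cos \<theta> - X * sin \<theta>) *\<^sub>R (- sin \<theta>, cos \<theta>, 0)"
    using 0(2) by (simp add: v)
  then show thesis
    by (rule that)
qed

lemma parallel_circle_has_derivative:
  "((\<lambda>\<theta>. (r * cos \<theta>, r * sin \<theta>, z)) has_derivative (\<lambda>h. (h * r) *\<^sub>R (- sin \<theta>, cos \<theta>, 0))) (at \<theta>)"
  by (auto intro!: derivative_eq_intros simp: mult_ac)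

text \<open>Differentiating both sides of the hypothesis, which says that \<open>\<Psi>\<close> maps a parallel circle to a
  parallel circle at equal angles.\<close>
lemma derivative_along_parallel_circle:
  fixes \<Psi> :: "real \<times> real \<times> real \<Rightarrow> real \<times> real \<times> real"
  assumes "(\<Psi> has_derivative D) (at (r * cos \<theta>, r * sin \<theta>, z))"
    and "\<forall>\<^sub>F s in nhds \<theta>. \<Psi> (r * cos s, r * sin s, z) = (r' * cos s, r' * sin s, z')"
  shows "r *\<^sub>R D (- sin \<theta>, cos \<theta>, 0) = r' *\<^sub>R (- sin \<theta>, cos \<theta>, 0)"
proof -
  let ?e = "(- sin \<theta>, cos \<theta>, 0) :: real \<times> real \<times> real"
  have "((\<lambda>s. \<Psi> (r * cos s, r * sin s, z)) has_derivative (\<lambda>h. D ((h * r) *\<^sub>R ?e))) (at \<theta>)"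
    using has_derivative_compose[OF parallel_circle_has_derivative assms(1)] .
  moreover have "\<Psi> (r * cos \<theta>, r * sin \<theta>, z) = (r' * cos \<theta>, r' * sin \<theta>, z')"
    using assms(2) eventually_nhds_x_imp_x by fast
  ultimately have "((\<lambda>s. (r' * cos s, r' * sin s, z')) has_derivative (\<lambda>h. D ((h * r) *\<^sub>R ?e))) (at \<theta>)"
    using assms(2) by (simp add: has_derivative_transform_eventually eventually_nhds_conv_at)
  then have "(\<lambda>h. D ((h * r) *\<^sub>R ?e)) = (\<lambda>h. (h * r') *\<^sub>R ?e)"
    using has_derivative_unique parallel_circle_has_derivative by blast
  then have "D ((1 * r) *\<^sub>R ?e) = (1 * r') *\<^sub>R ?e"
    by meson
  then show ?thesis
    using linear_scale[OF has_derivative_linear[OF assms(1)]] by (metis mult_1_left)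
qed

text \<open>By the inverse function theorem it suffices that the derivative of the plane map is injective.
  The only directions lost in the projection are the multiples of \<open>(- sin \<theta>, cos \<theta>, 0)\<close>, and the condition
  on the circle shows that the derivative of \<open>\<Psi>\<close> takes such multiples, and by injectivity no other
  vectors, to such multiples; a vector of the embedded plane is one of them only if it vanishes.\<close>
lemma diffeo_germ_halfplane_section:
  assumes "diffeo_germ A (halfplane_embedding \<theta> (x0, z0)) B (halfplane_embedding \<theta> (x1, z1)) \<Psi>"
    and "x1 \<noteq> 0"
    and circle: "\<forall>\<^sub>F s in nhds \<theta>. \<Psi> (x0 * cos s, x0 * sin s, z0) = (x1 * cos s, x1 * sin s, z1)"
  shows "diffeo_germ UNIV (x0, z0) UNIV (x1, z1)
    (\<lambda>q. halfplane_projection \<theta> (\<Psi> (halfplane_embedding \<theta> q)))"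
    (is "diffeo_germ _ _ _ _ ?\<psi>")
proof -
  let ?\<iota> = "halfplane_embedding \<theta>" and ?\<pi> = "halfplane_projection \<theta>"
  let ?e = "(- sin \<theta>, cos \<theta>, 0) :: real \<times> real \<times> real"
  obtain U V G where UV: "open U" "?\<iota> (x0, z0) \<in> U" "open V" "?\<iota> (x1, z1) \<in> V" "homeomorphism U V \<Psi> G"
    "smooth_on U \<Psi>" "smooth_on V G" and base: "\<Psi> (?\<iota> (x0, z0)) = ?\<iota> (x1, z1)"
    using assms(1) unfolding diffeo_germ_def by blast
  let ?D = "frechet_derivative \<Psi> (at (?\<iota> (x0, z0)))"
  have D: "(\<Psi> has_derivative ?D) (at (?\<iota> (x0, z0)))"
    using smooth_on_has_derivative[OF UV(6,2)] .
  have inj_D: "inj ?D"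
  proof -
    have "(G has_derivative frechet_derivative G (at (\<Psi> (?\<iota> (x0, z0))))) (at (\<Psi> (?\<iota> (x0, z0))))"
      using smooth_on_has_derivative[OF UV(7,4)] base by simp
    from has_derivative_compose[OF D this]
    have "((\<lambda>p. p) has_derivative (\<lambda>v. frechet_derivative G (at (\<Psi> (?\<iota> (x0, z0)))) (?D v))) (at (?\<iota> (x0, z0)))"
      by (rule has_derivative_transform_within_open[OF _ UV(1,2)]) (use UV(5) in \<open>simp add: homeomorphism_def\<close>)
    then have "(\<lambda>v. frechet_derivative G (at (\<Psi> (?\<iota> (x0, z0)))) (?D v)) = (\<lambda>v. v)"
      using has_derivative_unique has_derivative_ident by blast
    then show ?thesis
      by (metis injI)
  qed
  have e: "x0 *\<^sub>R ?D ?e = x1 *\<^sub>R ?e"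
    using derivative_along_parallel_circle[OF _ circle, of ?D] D by (simp add: halfplane_embedding_def)
  define S where "S = ?\<iota> -` U"
  have S: "open S" "(x0, z0) \<in> S"
    using UV(1,2) linear_continuous_on[OF bounded_linear_halfplane_embedding]
    by (auto simp: S_def intro: open_vimage)
  have sm: "smooth_on S ?\<psi>"
    by (intro smooth_on_linear[OF bounded_linear_halfplane_projection] S(1)
        smooth_on_compose[OF S(1) _ smooth_on_bounded_linear[OF bounded_linear_halfplane_embedding S(1)] UV(6)])
      (auto simp: S_def)
  have "(?\<psi> has_derivative (\<lambda>w. ?\<pi> (?D (?\<iota> w)))) (at (x0, z0))"
    using bounded_linear.has_derivative[OF bounded_linear_halfplane_projection
        has_derivative_compose[OF bounded_linear_imp_has_derivative[OF bounded_linear_halfplane_embedding] D]] .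
  then have D\<psi>: "frechet_derivative ?\<psi> (at (x0, z0)) = (\<lambda>w. ?\<pi> (?D (?\<iota> w)))"
    and lin: "linear (\<lambda>w. ?\<pi> (?D (?\<iota> w)))" (is "linear ?L")
    by (metis frechet_derivative_at, blast intro: has_derivative_linear)
  have "inj ?L"
    unfolding linear_injective_0[OF lin]
  proof (intro allI impI)
    \<comment> \<open>Both \<open>?D (?\<iota> w)\<close> and \<open>?D ?e\<close> are multiples of \<open>?e\<close>, the latter a nonzero one.\<close>
    fix w assume "?\<pi> (?D (?\<iota> w)) = 0"
    then obtain c where c: "?D (?\<iota> w) = c *\<^sub>R ?e"
      by (rule kernel_halfplane_projection)
    also have "\<dots> = (c / x1) *\<^sub>R (x0 *\<^sub>R ?D ?e)"
      using e assms(2) by simp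
    also have "\<dots> = ?D ((c * x0 / x1) *\<^sub>R ?e)"
      by (simp only: linear_scale[OF has_derivative_linear[OF D]] scaleR_scaleR) simp
    finally have "?\<iota> w = (c * x0 / x1) *\<^sub>R ?e"
      using inj_D by (simp only: inj_eq)
    then have "?\<pi> (?\<iota> w) = ?\<pi> ((c * x0 / x1) *\<^sub>R ?e)"
      by simp
    then show "w = 0"
      by (simp add: halfplane_projection_embedding) (simp add: halfplane_projection_def zero_prod_def)
  qed
  then have "diffeo_germ UNIV (x0, z0) UNIV (?\<psi> (x0, z0)) ?\<psi>"
    using diffeo_germ_plane_inverse_function[OF S sm] D\<psi> by simp
  then show ?thesis
    by (simp only: base halfplane_projection_embedding)
qed

section \<open>Germs of curves and of surfaces of revolution\<close>

lemma surface_of_revolution_eq_embedding: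
  "surface_of_revolution \<gamma> (t, \<theta>) = halfplane_embedding \<theta> (\<gamma> t)"
  by (simp add: surface_of_revolution_def halfplane_embedding_def case_prod_unfold)

lemma eventually_nhds_fst: "eventually P (nhds a) \<Longrightarrow> \<forall>\<^sub>F p in nhds (a, b). P (fst p)"
  by (rule eventually_compose_filterlim, assumption) (use tendsto_fst[OF filterlim_ident] in fastforce)

lemma eventually_nhds_Pair1: "eventually P (nhds (a, b)) \<Longrightarrow> \<forall>\<^sub>F t in nhds a. P (t, b)"
  by (rule eventually_compose_filterlim) (auto intro!: tendsto_Pair filterlim_ident)

lemma eventually_nhds_Pair2: "eventually P (nhds (a, b)) \<Longrightarrow> \<forall>\<^sub>F t in nhds b. P (a, t)"
  by (rule eventually_compose_filterlim) (auto intro!: tendsto_Pair filterlim_ident)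

theorem theorem3p15:
  fixes I I' :: "real set" and t0 t0' :: real
    and \<gamma> \<gamma>' :: "real \<Rightarrow> real \<times> real"
    and x0 z0 x0' z0' \<theta>0 :: real
  assumes "is_interval I" and "t0 \<in> interior I"
    and "is_interval I'" and "t0' \<in> interior I'"
    and "smooth_germ I t0 UNIV (x0, z0) \<gamma>"
    and "smooth_germ I' t0' UNIV (x0', z0') \<gamma>'"
    and "x0 > 0" and "x0' > 0"
    and "0 \<le> \<theta>0" and "\<theta>0 < 2 * pi"
  shows
    "(\<forall>\<phi> \<psi>.
        diffeo_germ I t0 I' t0' \<phi> \<longrightarrow>
        diffeo_germ UNIV (x0, z0) UNIV (x0', z0') \<psi> \<longrightarrow>
        (\<forall>\<^sub>F t in nhds t0. \<psi> (\<gamma> t) = \<gamma>' (\<phi> t)) \<longrightarrow>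
        (\<exists>\<Phi> \<Psi>.
           diffeo_germ (I \<times> UNIV) (t0, \<theta>0) (I' \<times> UNIV) (t0', \<theta>0) \<Phi> \<and>
           (\<forall>\<^sub>F (t, \<theta>) in nhds (t0, \<theta>0). \<Phi> (t, \<theta>) = (\<phi> t, \<theta>)) \<and>
           diffeo_germ off_axis (surface_of_revolution \<gamma> (t0, \<theta>0))
             off_axis (surface_of_revolution \<gamma>' (t0', \<theta>0)) \<Psi> \<and>
           (\<forall>\<^sub>F (X, Y, Z) in nhds (surface_of_revolution \<gamma> (t0, \<theta>0)).
              \<Psi> (X, Y, Z) =
                (X * fst (\<psi> (sqrt (X\<^sup>2 + Y\<^sup>2), Z)) / sqrt (X\<^sup>2 + Y\<^sup>2),
                 Y * fst (\<psi> (sqrt (X\<^sup>2 + Y\<^sup>2), Z)) / sqrt (X\<^sup>2 + Y\<^sup>2),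
                 snd (\<psi> (sqrt (X\<^sup>2 + Y\<^sup>2), Z)))) \<and>
           (\<forall>\<^sub>F p in nhds (t0, \<theta>0).
              \<Psi> (surface_of_revolution \<gamma> p) = surface_of_revolution \<gamma>' (\<Phi> p))))
     \<and>
     (\<forall>\<phi> \<Phi> \<Psi>.
        diffeo_germ (I \<times> UNIV) (t0, \<theta>0) (I' \<times> UNIV) (t0', \<theta>0) \<Phi> \<longrightarrow>
        (\<forall>\<^sub>F (t, \<theta>) in nhds (t0, \<theta>0). \<Phi> (t, \<theta>) = (\<phi> t, \<theta>)) \<longrightarrow>
        diffeo_germ off_axis (surface_of_revolution \<gamma> (t0, \<theta>0))
          off_axis (surface_of_revolution \<gamma>' (t0', \<theta>0)) \<Psi> \<longrightarrow>
        (\<forall>\<^sub>F p in nhds (t0, \<theta>0).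
           \<Psi> (surface_of_revolution \<gamma> p) = surface_of_revolution \<gamma>' (\<Phi> p)) \<longrightarrow>
        (\<exists>\<psi>.
           diffeo_germ UNIV (x0, z0) UNIV (x0', z0') \<psi> \<and>
           (\<forall>\<^sub>F (X, Z) in nhds (x0, z0).
              \<psi> (X, Z) =
                (fst (\<Psi> (X * cos \<theta>0, X * sin \<theta>0, Z)) * cos \<theta>0
                   + fst (snd (\<Psi> (X * cos \<theta>0, X * sin \<theta>0, Z))) * sin \<theta>0,
                 snd (snd (\<Psi> (X * cos \<theta>0, X * sin \<theta>0, Z))))) \<and>
           (\<forall>\<^sub>F t in nhds t0. \<psi> (\<gamma> t) = \<gamma>' (\<phi> t))))"
proof (intro conjI allI impI, goal_cases)
  have \<gamma>0: "\<gamma> t0 = (x0, z0)" and \<gamma>0': "\<gamma>' t0' = (x0', z0')"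
    using assms(5,6) by (auto simp: smooth_germ_def)
  {
    case (1 \<phi> \<psi>)
    obtain U where "open U" "t0 \<in> U" "continuous_on U \<gamma>"
      using assms(5) smooth_on_imp_continuous_on unfolding smooth_germ_def by blast
    moreover have "open {q :: real \<times> real. 0 < fst q}"
      by (intro open_Collect_less continuous_intros)
    ultimately have "open (U \<inter> \<gamma> -` {q. 0 < fst q})" "t0 \<in> U \<inter> \<gamma> -` {q. 0 < fst q}"
      using \<gamma>0 assms(7) by (blast intro: continuous_open_preimage, simp)
    then have "\<forall>\<^sub>F t in nhds t0. 0 < fst (\<gamma> t)"
      unfolding eventually_nhds by blast
    with 1(3) have "\<forall>\<^sub>F t in nhds t0. \<psi> (\<gamma> t) = \<gamma>' (\<phi> t) \<and> 0 < fst (\<gamma> t)"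
      by eventually_elim simp
    then have "\<forall>\<^sub>F p in nhds (t0, \<theta>0). \<psi> (\<gamma> (fst p)) = \<gamma>' (\<phi> (fst p)) \<and> 0 < fst (\<gamma> (fst p))"
      by (rule eventually_nhds_fst)
    then have "\<forall>\<^sub>F p in nhds (t0, \<theta>0). revolve \<psi> (surface_of_revolution \<gamma> p) =
        surface_of_revolution \<gamma>' ((\<lambda>(t, \<theta>). (\<phi> t, \<theta>)) p)"
      by eventually_elim (auto simp: surface_of_revolution_def revolve_meridian meridian_polar split_beta)
    moreover have "diffeo_germ off_axis (surface_of_revolution \<gamma> (t0, \<theta>0))
        off_axis (surface_of_revolution \<gamma>' (t0', \<theta>0)) (revolve \<psi>)"
      using diffeo_germ_revolve[OF 1(2) assms(7,8)] \<gamma>0 \<gamma>0' by (simp add: surface_of_revolution_def)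
    ultimately show ?case
      using diffeo_germ_times_UNIV[OF 1(1), of \<theta>0]
      by (intro exI[of _ "\<lambda>(t, \<theta>). (\<phi> t, \<theta>)"] exI[of _ "revolve \<psi>"]) (simp add: revolve_def case_prod_unfold)
  next
    case (2 \<phi> \<Phi> \<Psi>)
    have \<phi>0: "\<phi> t0 = t0'"
      using eventually_nhds_x_imp_x[OF 2(2)] 2(1) by (simp add: diffeo_germ_def)
    have *: "\<forall>\<^sub>F p in nhds (t0, \<theta>0). \<Psi> (surface_of_revolution \<gamma> p) = surface_of_revolution \<gamma>' (\<phi> (fst p), snd p)"
      using 2(2,4) by eventually_elim auto
    let ?\<psi> = "\<lambda>q. halfplane_projection \<theta>0 (\<Psi> (halfplane_embedding \<theta>0 q))"
    have "diffeo_germ UNIV (x0, z0) UNIV (x0', z0') ?\<psi>"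
    proof (rule diffeo_germ_halfplane_section)
      show "diffeo_germ off_axis (halfplane_embedding \<theta>0 (x0, z0)) off_axis (halfplane_embedding \<theta>0 (x0', z0')) \<Psi>"
        using 2(3) by (simp add: surface_of_revolution_eq_embedding \<gamma>0 \<gamma>0')
      show "\<forall>\<^sub>F s in nhds \<theta>0. \<Psi> (x0 * cos s, x0 * sin s, z0) = (x0' * cos s, x0' * sin s, z0')"
        using eventually_nhds_Pair2[OF *] by (simp add: surface_of_revolution_def \<phi>0 \<gamma>0 \<gamma>0')
    qed (use assms(7,8) in auto)
    moreover have "\<forall>\<^sub>F t in nhds t0. ?\<psi> (\<gamma> t) = \<gamma>' (\<phi> t)"
      using eventually_nhds_Pair1[OF *]
      by eventually_elim (simp add: surface_of_revolution_eq_embedding halfplane_projection_embedding)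
    ultimately show ?case
      by (intro exI[of _ ?\<psi>]) (simp add: halfplane_projection_def halfplane_embedding_def case_prod_unfold)
  }
qed

end
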